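(* Let $\mathbb{H}$ be a finite-dimensional Hilbert space over $\mathbb{K}\in\{\mathbb{R},\mathbb{C}\}$ and let $T\in\mathbb{L}(\mathbb{H})$. Then $T$ is an extreme contraction if and only if $T$ is an isometry.
   Context: $\mathbb{L}(\mathbb{H})$ denotes the space of bounded linear operators from $\mathbb{H}$ to itself, with the operator norm. $T\in\mathbb{L}(\mathbb{H})$ is a contraction if $\|T\|\le 1$, and is an extreme contraction if in addition it is an extreme point of the closed unit ball of $\mathbb{L}(\mathbb{H})$. *)

theory Defs
  imports "HOL-Analysis.Analysis"
begin

text \<open>
  Real inner product spaces are the class \<open>real_inner\<close>; the following class is its complex
  counterpart. The underlying real normed space structure is required to be the one induced
  by the complex scalar multiplication and the inner product. The inner product is linear in
  its first argument. A Hilbert space is a type in \<open>{real_inner, banach}\<close>, respectively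
  in \<open>{complex_inner, banach}\<close>.
\<close>

class complex_inner = real_normed_vector +
  fixes scaleC :: "complex \<Rightarrow> 'a \<Rightarrow> 'a" (infixr "*\<^sub>C" 75)
    and cinner :: "'a \<Rightarrow> 'a \<Rightarrow> complex"
  assumes scaleC_of_real: "complex_of_real r *\<^sub>C x = r *\<^sub>R x"
    and scaleC_add_right: "a *\<^sub>C (x + y) = a *\<^sub>C x + a *\<^sub>C y"
    and scaleC_add_left: "(a + b) *\<^sub>C x = a *\<^sub>C x + b *\<^sub>C x"
    and scaleC_scaleC: "a *\<^sub>C b *\<^sub>C x = (a * b) *\<^sub>C x"
    and scaleC_one: "1 *\<^sub>C x = x"
    and cinner_commute: "cinner x y = cnj (cinner y x)"
    and cinner_add_left: "cinner (x + y) z = cinner x z + cinner y z"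
    and cinner_scaleC_left: "cinner (a *\<^sub>C x) y = a * cinner x y"
    and cinner_ge_zero: "0 \<le> Re (cinner x x)"
    and cinner_eq_zero_iff: "cinner x x = 0 \<longleftrightarrow> x = 0"
    and norm_eq_sqrt_cinner: "norm x = sqrt (Re (cinner x x))"

global_interpretation complex_vector: vector_space "scaleC :: complex \<Rightarrow> 'a::complex_inner \<Rightarrow> 'a"
  by unfold_locales
    (simp_all add: scaleC_add_right scaleC_add_left scaleC_scaleC scaleC_one)

instantiation complex :: complex_inner
begin

definition scaleC_complex :: "complex \<Rightarrow> complex \<Rightarrow> complex"
  where "scaleC_complex a x = a * x"

definition cinner_complex :: "complex \<Rightarrow> complex \<Rightarrow> complex"
  where "cinner_complex x y = x * cnj y"

instance
  by standard
    (simp_all add: scaleC_complex_def cinner_complex_def scaleR_conv_of_real algebra_simps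
      cmod_def power2_eq_square)

end

text \<open>
  The definitions below take the scalar multiplication as a parameter, so that the real case
  (\<open>scaleR\<close>) and the complex case (\<open>scaleC\<close>) are covered uniformly.
\<close>

definition finite_dimensional :: "('k::field \<Rightarrow> 'a::ab_group_add \<Rightarrow> 'a) \<Rightarrow> bool"
  where "finite_dimensional smul \<longleftrightarrow> (\<exists>B. finite B \<and> module.span smul B = UNIV)"

text \<open>
  The space of bounded operators that are linear over the scalar field, as a subspace of the
  real normed space of bounded real-linear maps, whose norm is the operator norm. For
  \<open>scaleR\<close> it is the whole type.
\<close>

definition bounded_operators ::
    "('k::field \<Rightarrow> 'a::real_normed_vector \<Rightarrow> 'a) \<Rightarrow> ('a \<Rightarrow>\<^sub>L 'a) set"
  where "bounded_operators smul = {T. Vector_Spaces.linear smul smul (blinfun_apply T)}"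

lemma bounded_operators_scaleR: "bounded_operators scaleR = UNIV"
  unfolding bounded_operators_def
  using bounded_linear.linear[OF blinfun.bounded_linear_right] by (auto simp: linear_def)

definition contraction :: "('a::real_normed_vector \<Rightarrow>\<^sub>L 'a) \<Rightarrow> bool"
  where "contraction T \<longleftrightarrow> norm T \<le> 1"

definition extreme_contraction ::
    "('k::field \<Rightarrow> 'a::real_normed_vector \<Rightarrow> 'a) \<Rightarrow> ('a \<Rightarrow>\<^sub>L 'a) \<Rightarrow> bool"
  where "extreme_contraction smul T \<longleftrightarrow>
    contraction T \<and> T extreme_point_of (cball 0 1 \<inter> bounded_operators smul)"

definition isometry :: "('a::real_normed_vector \<Rightarrow>\<^sub>L 'a) \<Rightarrow> bool"
  where "isometry T \<longleftrightarrow> (\<forall>x. norm (blinfun_apply T x) = norm x)"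

end

theory Submission
  imports Defs
begin

text \<open>
  If \<open>T\<close> is an isometry, then \<open>T x\<close> lies on the sphere of radius \<open>norm x\<close>, and strict convexity of
  the norm forces any two contractions having \<open>T\<close> strictly between them to agree at \<open>x\<close>.

  Conversely, let \<open>T\<close> be a contraction that is not an isometry. Then \<open>I - T\<^sup>*T \<noteq> 0\<close>, and in finite
  dimension also \<open>I - TT\<^sup>* \<noteq> 0\<close>. Choose \<open>u\<close> and \<open>y\<close> outside the respective kernels and put
  \<open>w = (I - TT\<^sup>*) y\<close> and \<open>R x = \<epsilon> \<langle>x, (I - T\<^sup>*T) u\<rangle> w\<close>. Since \<open>T\<^sup>* w = (I - T\<^sup>*T) T\<^sup>* y\<close>, the
  Cauchy--Schwarz inequality for the positive semidefinite form \<open>\<langle>(I - T\<^sup>*T) x, y\<rangle>\<close> bounds both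
  \<open>\<bar>\<langle>T x, R x\<rangle>\<bar>\<close> and \<open>\<parallel>R x\<parallel>\<^sup>2\<close> by small multiples of \<open>\<parallel>x\<parallel>\<^sup>2 - \<parallel>T x\<parallel>\<^sup>2\<close>. Hence \<open>T \<plusminus> R\<close> are
  contractions for small \<open>\<epsilon> > 0\<close>, and \<open>T\<close> is their midpoint.
\<close>

lemma contraction_norm_le:
  assumes "contraction T"
  shows "norm (blinfun_apply T x) \<le> norm x"
proof -
  have "norm (blinfun_apply T x) \<le> norm T * norm x"
    by (rule norm_blinfun)
  also have "\<dots> \<le> 1 * norm x"
    using assms unfolding contraction_def by (intro mult_right_mono) auto
  finally show ?thesis
    by simp
qed

text \<open>
  The real and the complex case are treated at once; \<open>cj\<close> is the identity on the reals and complex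
  conjugation on the complex numbers.
\<close>

locale inner_product_space = vector_space scale
  for scale :: "'k::real_normed_field \<Rightarrow> 'a::real_normed_vector \<Rightarrow> 'a" (infixr "\<odot>" 75) +
  fixes ip :: "'a \<Rightarrow> 'a \<Rightarrow> 'k" and cj :: "'k \<Rightarrow> 'k"
  assumes scale_of_real: "of_real r \<odot> x = r *\<^sub>R x"
    and ip_add_left: "ip (x + y) z = ip x z + ip y z"
    and ip_scale_left: "ip (a \<odot> x) y = a * ip x y"
    and ip_commute: "ip x y = cj (ip y x)"
    and ip_self: "ip x x = of_real ((norm x)\<^sup>2)"
    and cj_add: "cj (a + b) = cj a + cj b"
    and cj_mult: "cj (a * b) = cj a * cj b"
    and cj_cj: "cj (cj a) = a"
    and norm_cj: "norm (cj a) = norm a"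
    and mult_cj: "a * cj a = of_real ((norm a)\<^sup>2)"
    and cj_of_real: "cj (of_real r) = of_real r"
begin

section \<open>Sesquilinear algebra and the norm\<close>

lemma ip_add_right: "ip x (y + z) = ip x y + ip x z"
  by (metis cj_add ip_add_left ip_commute)

lemma ip_scale_right: "ip x (a \<odot> y) = cj a * ip x y"
  by (metis cj_mult ip_scale_left ip_commute)

lemma ip_zero_left: "ip 0 y = 0"
  using ip_add_left[of 0 0 y] by simp

lemma ip_zero_right: "ip x 0 = 0"
  using ip_add_right[of x 0 0] by simp

lemma ip_minus_left: "ip (- x) y = - ip x y"
  using ip_add_left[of x "- x" y] by (simp add: ip_zero_left add_eq_0_iff)

lemma ip_minus_right: "ip x (- y) = - ip x y"
  using ip_add_right[of x y "- y"] by (simp add: ip_zero_right add_eq_0_iff)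

lemma ip_diff_left: "ip (x - y) z = ip x z - ip y z"
  using ip_add_left[of x "- y" z] by (simp add: ip_minus_left)

lemma ip_diff_right: "ip x (y - z) = ip x y - ip x z"
  using ip_add_right[of x y "- z"] by (simp add: ip_minus_right)

lemma ip_scaleR_left: "ip (r *\<^sub>R x) y = of_real r * ip x y"
  by (metis scale_of_real ip_scale_left)

lemma ip_scaleR_right: "ip x (r *\<^sub>R y) = of_real r * ip x y"
  by (metis scale_of_real ip_scale_right cj_of_real)

lemmas ip_simps = ip_add_left ip_add_right ip_diff_left ip_diff_right
  ip_scale_left ip_scale_right ip_scaleR_left ip_scaleR_right

lemma ip_self_eq_0_iff: "ip x x = 0 \<longleftrightarrow> x = 0"
  by (simp add: ip_self)

text \<open>The ambient norm is a priori homogeneous only over the reals; over the scalar field this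
  comes from the inner product.\<close>

lemma norm_scale: "norm (a \<odot> x) = norm a * norm x"
proof -
  have "(of_real ((norm (a \<odot> x))\<^sup>2) :: 'k) = (a * cj a) * ip x x"
    by (simp only: ip_self[symmetric] ip_simps ac_simps)
  also have "\<dots> = of_real ((norm a * norm x)\<^sup>2)"
    by (simp add: mult_cj ip_self power_mult_distrib)
  finally have "(norm (a \<odot> x))\<^sup>2 = (norm a * norm x)\<^sup>2"
    by (simp only: of_real_eq_iff)
  then show ?thesis
    by simp
qed

text \<open>The two cross terms are conjugate, hence of equal modulus; keeping only moduli avoids
  real parts, which have no uniform name over both fields.\<close>

lemma norm_add_square_le: "(norm (x + y))\<^sup>2 \<le> (norm x)\<^sup>2 + 2 * norm (ip x y) + (norm y)\<^sup>2"
proof -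
  have "(of_real ((norm (x + y))\<^sup>2 - (norm x)\<^sup>2 - (norm y)\<^sup>2) :: 'k) = ip x y + ip y x"
    by (simp only: of_real_diff ip_self[symmetric] ip_simps) simp
  then have "\<bar>(norm (x + y))\<^sup>2 - (norm x)\<^sup>2 - (norm y)\<^sup>2\<bar> = norm (ip x y + ip y x)"
    by (metis norm_of_real)
  also have "\<dots> \<le> norm (ip x y) + norm (ip y x)"
    by (rule norm_triangle_ineq)
  also have "norm (ip y x) = norm (ip x y)"
    by (metis ip_commute norm_cj)
  finally show ?thesis
    by linarith
qed

lemma norm_convex_combination_square:
  fixes x y :: 'a
  shows "(norm ((1 - t) *\<^sub>R x + t *\<^sub>R y))\<^sup>2
     = (1 - t) * (norm x)\<^sup>2 + t * (norm y)\<^sup>2 - t * (1 - t) * (norm (x - y))\<^sup>2"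
proof -
  have "(of_real ((norm ((1 - t) *\<^sub>R x + t *\<^sub>R y))\<^sup>2) :: 'k)
     = of_real ((1 - t) * (norm x)\<^sup>2 + t * (norm y)\<^sup>2 - t * (1 - t) * (norm (x - y))\<^sup>2)"
    by (simp only: of_real_diff of_real_add of_real_mult ip_self[symmetric] ip_simps of_real_1)
       algebra
  then show ?thesis
    by (simp only: of_real_eq_iff)
qed

text \<open>In the preceding identity the first two terms sum to at most \<open>r\<close> squared,
  so the subtracted term has to vanish.\<close>

lemma strict_convexity:
  fixes x y :: 'a
  assumes "norm x \<le> r" "norm y \<le> r" "norm ((1 - t) *\<^sub>R x + t *\<^sub>R y) = r" "0 < t" "t < 1"
  shows "x = y"
proof -
  have "(norm x)\<^sup>2 \<le> r\<^sup>2" "(norm y)\<^sup>2 \<le> r\<^sup>2"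
    using assms by (auto intro: power_mono)
  then have "(1 - t) * (norm x)\<^sup>2 \<le> (1 - t) * r\<^sup>2" "t * (norm y)\<^sup>2 \<le> t * r\<^sup>2"
    using assms by (auto intro: mult_left_mono)
  moreover have "(1 - t) * r\<^sup>2 + t * r\<^sup>2 = r\<^sup>2"
    by algebra
  ultimately have "t * (1 - t) * (norm (x - y))\<^sup>2 \<le> 0"
    using norm_convex_combination_square[of t x y] assms(3) by simp
  moreover have "0 < t * (1 - t)"
    using assms by simp
  ultimately have "(norm (x - y))\<^sup>2 \<le> 0"
    by (meson mult_pos_pos not_le)
  then show ?thesis
    by simp
qed

section \<open>Riesz representation and finite dimension\<close>

text \<open>Gram-Schmidt by induction on the spanning set. The functional stays arbitrary because
  the induction hypothesis is used twice: for \<open>f\<close>, and to project the new vector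
  \<open>b\<close> onto \<open>span B\<close>.\<close>

lemma riesz_representation_span:
  assumes "finite B" "Vector_Spaces.linear scale (*) f"
  shows "\<exists>z\<in>span B. \<forall>x\<in>span B. f x = ip x z"
  using assms
proof (induction B arbitrary: f rule: finite_induct)
  case empty
  interpret f: Vector_Spaces.linear scale "(*)" f by fact
  show ?case
    by (simp add: ip_zero_right f.zero)
next
  case (insert b B)
  interpret f: Vector_Spaces.linear scale "(*)" f by fact
  obtain z where z: "z \<in> span B" "\<And>x. x \<in> span B \<Longrightarrow> f x = ip x z"
    using insert.IH[OF insert.prems] by blast
  have "Vector_Spaces.linear scale (*) (\<lambda>x. ip x b)"
    by (intro Vector_Spaces.linear.intro module_hom.intro)
       (unfold_locales, simp_all add: ip_simps algebra_simps)
  \<comment> \<open>\<open>p\<close> is the orthogonal projection of \<open>b\<close> onto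
    \<open>span B\<close>.\<close>
  then obtain p where p: "p \<in> span B" "\<And>x. x \<in> span B \<Longrightarrow> ip x b = ip x p"
    using insert.IH by blast
  define e where "e = b - p"
  have orth: "ip x e = 0" if "x \<in> span B" for x
    using p(2)[OF that] by (simp add: e_def ip_diff_right)
  have orth': "ip e x = 0" if "x \<in> span B" for x
    by (metis orth[OF that] ip_commute ip_zero_left)
  \<comment> \<open>If \<open>b\<close> already lies in \<open>span B\<close>, then
    \<open>e = 0\<close> and division by zero makes \<open>c = 0\<close>, which is consistent with
    \<open>f e = 0\<close>.\<close>
  define c where "c = f e / ip e e"
  have fe: "f e = c * ip e e"
    by (cases "e = 0") (simp_all add: c_def f.zero ip_self_eq_0_iff ip_zero_left)
  have sub: "span B \<subseteq> span (insert b B)"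
    by (intro span_mono) blast
  have "e \<in> span (insert b B)"
    unfolding e_def using p(1) sub by (auto intro: span_diff span_base)
  then have mem: "z + cj c \<odot> e \<in> span (insert b B)"
    using z(1) sub by (auto intro: span_add span_scale)
  have "f x = ip x (z + cj c \<odot> e)" if x: "x \<in> span (insert b B)" for x
  proof -
    obtain k where k: "x - k \<odot> b \<in> span B"
      using x span_breakdown_eq by blast
    define s where "s = (x - k \<odot> b) + k \<odot> p"
    have s: "s \<in> span B"
      unfolding s_def using k p(1) by (auto intro: span_add span_scale)
    have x_eq: "x = s + k \<odot> e"
      by (simp add: s_def e_def scale_right_diff_distrib)
    show ?thesis
      unfolding x_eq
      by (simp add: f.add f.scale ip_simps fe z(2)[OF s] orth[OF s] orth'[OF z(1)] cj_cj)
  qed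
  with mem show ?case
    by blast
qed

lemma riesz_representation:
  assumes "finite_dimensional scale" "Vector_Spaces.linear scale (*) f"
  shows "\<exists>z. \<forall>x. f x = ip x z"
  using assms riesz_representation_span unfolding finite_dimensional_def by (metis UNIV_I)

lemma surjective_imp_injective:
  assumes "finite_dimensional scale" "Vector_Spaces.linear scale scale f" "surj f"
  shows "inj f"
proof -
  obtain S where S: "finite S" "span S = UNIV"
    using assms(1) unfolding finite_dimensional_def by blast
  obtain B where B: "B \<subseteq> S" "independent B" "span B = UNIV"
    using maximal_independent_subset[of S] S(2) span_subspace subspace_UNIV
    by (metis (no_types) UNIV_I span_mono span_span subset_UNIV subset_antisym)
  interpret finite_dimensional_vector_space scale B
    using B S(1) by unfold_locales (auto intro: finite_subset)
  show ?thesis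
    by (rule linear_surj_imp_inj[OF assms(2,3)])
qed

section \<open>Perturbing a contraction that is not an isometry\<close>

text \<open>Cauchy--Schwarz for the defect form \<open>\<langle>x, y\<rangle> - \<langle>T x, T y\<rangle>\<close>, which may be degenerate. The slack
  in \<open>K\<close> avoids a case distinction on whether the form vanishes at \<open>(z, z)\<close>.\<close>

lemma defect_Cauchy_Schwarz:
  assumes lin: "Vector_Spaces.linear scale scale T"
    and contr: "\<And>x. norm (T x) \<le> norm x"
    and K: "0 < K" "(norm z)\<^sup>2 \<le> K"
  shows "(norm (ip x z - ip (T x) (T z)))\<^sup>2 \<le> K * ((norm x)\<^sup>2 - (norm (T x))\<^sup>2)"
proof -
  interpret T: Vector_Spaces.linear scale scale T by fact
  define b where "b = ip x z - ip (T x) (T z)"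
  define q where "q = (\<lambda>x. (norm x)\<^sup>2 - (norm (T x))\<^sup>2)"
  have q: "of_real (q v) = ip v v - ip (T v) (T v)" for v
    by (simp add: q_def ip_self)
  have q_nonneg: "0 \<le> q v" for v
    using contr[of v] by (simp add: q_def power_mono)
  have cj_b: "cj b = ip z x - ip (T z) (T x)"
    using cj_add[of b "ip (T x) (T z)"] ip_commute[of z x] ip_commute[of "T z" "T x"]
    by (simp add: b_def)
  \<comment> \<open>Classically one subtracts \<open>b / q z\<close> times \<open>z\<close>;
    replacing \<open>q z\<close> by its upper bound \<open>K\<close> still leaves
    \<open>t * (norm b)\<^sup>2 \<le> q x\<close>.\<close>
  define t where "t = 1 / K"
  have "of_real (q (x - (of_real t * b) \<odot> z))
      = of_real (q x) - 2 * of_real t * (b * cj b) + (of_real t)\<^sup>2 * (b * cj b) * of_real (q z)"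
    unfolding q T.diff T.scale ip_simps cj_mult cj_of_real cj_b
    unfolding b_def by algebra
  also have "\<dots> = of_real (q x - 2 * t * (norm b)\<^sup>2 + t\<^sup>2 * (norm b)\<^sup>2 * q z)"
    by (simp add: mult_cj)
  finally have "q (x - (of_real t * b) \<odot> z) = q x - 2 * t * (norm b)\<^sup>2 + t\<^sup>2 * (norm b)\<^sup>2 * q z"
    by (simp only: of_real_eq_iff)
  then have "2 * t * (norm b)\<^sup>2 \<le> q x + t\<^sup>2 * (norm b)\<^sup>2 * q z"
    using q_nonneg[of "x - (of_real t * b) \<odot> z"] by linarith
  also have "t\<^sup>2 * (norm b)\<^sup>2 * q z \<le> t\<^sup>2 * (norm b)\<^sup>2 * K"
    using K(2) by (intro mult_left_mono) (auto simp: q_def intro: order_trans[rotated])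
  also have "t\<^sup>2 * (norm b)\<^sup>2 * K = t * (norm b)\<^sup>2"
    using K(1) by (simp add: t_def power2_eq_square)
  finally have "t * (norm b)\<^sup>2 \<le> q x"
    by simp
  then show ?thesis
    using K(1) by (simp add: t_def b_def[symmetric] q_def field_simps)
qed

text \<open>Here \<open>z\<close> stands for the adjoint of \<open>T\<close> applied to
  \<open>y\<close>; only this one value of the adjoint is required.\<close>

lemma exists_nonzero_perturbation:
  assumes lin: "Vector_Spaces.linear scale scale T"
    and contr: "\<And>x. norm (T x) \<le> norm x"
    and u: "norm (T u) \<noteq> norm u"
    and adj: "\<And>x. ip (T x) y = ip x z"
    and ne: "y \<noteq> T z"
  shows "\<exists>R v. Vector_Spaces.linear scale scale R \<and> R v \<noteq> 0
           \<and> (\<forall>x. norm (T x + R x) \<le> norm x \<and> norm (T x - R x) \<le> norm x)"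
proof -
  interpret T: Vector_Spaces.linear scale scale T by fact
  define w where "w = y - T z"
  define b where "b = (\<lambda>x v. ip x v - ip (T x) (T v))"
  \<comment> \<open>One constant serves both \<open>u\<close> and \<open>z\<close> in the
    Cauchy-Schwarz bound; the summand 1 makes it positive.\<close>
  define K where "K = 1 + (norm u)\<^sup>2 + (norm z)\<^sup>2"
  have K: "0 < K" "(norm u)\<^sup>2 \<le> K" "(norm z)\<^sup>2 \<le> K"
    by (simp_all add: K_def add_pos_nonneg)
  \<comment> \<open>Chosen so that
    \<open>\<epsilon> * (2 * K + K * (norm w)\<^sup>2) \<le> 1\<close>. The extra 1 in the
    denominator also yields \<open>\<epsilon> \<le> 1\<close>, which absorbs one factor of the
    square of \<open>\<epsilon>\<close>.\<close>
  define \<epsilon> where "\<epsilon> = 1 / (1 + 2 * K + K * (norm w)\<^sup>2)"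
  have den: "0 < 1 + 2 * K + K * (norm w)\<^sup>2" "1 \<le> 1 + 2 * K + K * (norm w)\<^sup>2"
    using K(1) by (simp_all add: add_pos_nonneg)
  have \<epsilon>: "0 < \<epsilon>" "\<epsilon> \<le> 1"
    using den by (simp_all add: \<epsilon>_def)
  define R where "R = (\<lambda>x. (of_real \<epsilon> * b x u) \<odot> w)"
  have b_add: "b (x + x') v = b x v + b x' v" and b_scale: "b (a \<odot> x) v = a * b x v" for a x x' v
    by (simp_all add: b_def T.add T.scale ip_simps algebra_simps)
  have lin_R: "Vector_Spaces.linear scale scale R"
    by (intro Vector_Spaces.linear.intro module_hom.intro)
       (unfold_locales, simp_all add: R_def b_add b_scale distrib_left scale_left_distrib mult.left_commute)
  have "b u u = of_real ((norm u)\<^sup>2 - (norm (T u))\<^sup>2)"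
    by (simp add: b_def ip_self)
  then have "b u u \<noteq> 0"
    using u by (simp del: of_real_diff of_real_power)
  then have R_nz: "R u \<noteq> 0"
    using \<epsilon> ne by (simp add: R_def w_def)
  have bound: "norm (T x + s *\<^sub>R R x) \<le> norm x" if s: "\<bar>s\<bar> = 1" for x s
  proof -
    define q where "q = (norm x)\<^sup>2 - (norm (T x))\<^sup>2"
    have bu: "(norm (b x u))\<^sup>2 \<le> K * q" and bz: "(norm (b x z))\<^sup>2 \<le> K * q"
      unfolding b_def q_def by (intro defect_Cauchy_Schwarz lin contr K)+
    have q_nonneg: "0 \<le> q"
      using contr[of x] by (simp add: q_def power_mono)
    \<comment> \<open>The choice of \<open>w\<close> turns the cross term into a value of the defect
      form, so it is small wherever \<open>T\<close> nearly preserves the norm.\<close>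
    have "ip (T x) w = b x z"
      by (simp add: w_def b_def ip_diff_right adj)
    then have "norm (ip (T x) (s *\<^sub>R R x)) = \<epsilon> * (norm (b x u) * norm (b x z))"
      using \<epsilon> s by (simp add: R_def ip_simps norm_mult norm_cj cj_mult cj_of_real)
    moreover have "2 * (norm (b x u) * norm (b x z)) \<le> (norm (b x u))\<^sup>2 + (norm (b x z))\<^sup>2"
      using sum_squares_bound[of "norm (b x u)" "norm (b x z)"] by (simp add: mult.assoc)
    then have "2 * (norm (b x u) * norm (b x z)) \<le> 2 * K * q"
      using bu bz by linarith
    then have "\<epsilon> * (2 * (norm (b x u) * norm (b x z))) \<le> \<epsilon> * (2 * K * q)"
      using \<epsilon> by (intro mult_left_mono) auto
    moreover have "(norm (s *\<^sub>R R x))\<^sup>2 \<le> \<epsilon> * (K * (norm w)\<^sup>2 * q)"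
    proof -
      have "(norm (s *\<^sub>R R x))\<^sup>2 = \<epsilon> * (\<epsilon> * ((norm w)\<^sup>2 * (norm (b x u))\<^sup>2))"
        using \<epsilon> s by (simp add: R_def norm_scale norm_mult power_mult_distrib power2_eq_square)
      also have "\<dots> \<le> \<epsilon> * (1 * ((norm w)\<^sup>2 * (K * q)))"
        using \<epsilon> bu K(1) q_nonneg by (intro mult_left_mono mult_mono) auto
      finally show ?thesis
        by (simp add: algebra_simps)
    qed
    ultimately have "2 * norm (ip (T x) (s *\<^sub>R R x)) + (norm (s *\<^sub>R R x))\<^sup>2
        \<le> \<epsilon> * (2 * K + K * (norm w)\<^sup>2) * q"
      by (simp add: algebra_simps)
    also have "\<dots> \<le> 1 * q"
      using den q_nonneg by (intro mult_right_mono) (simp_all add: \<epsilon>_def)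
    finally have "(norm (T x + s *\<^sub>R R x))\<^sup>2 \<le> (norm x)\<^sup>2"
      using norm_add_square_le[of "T x" "s *\<^sub>R R x"] unfolding q_def mult_1 by argo
    then show ?thesis
      by (rule power2_le_imp_le) simp
  qed
  have "norm (T x + R x) \<le> norm x \<and> norm (T x - R x) \<le> norm x" for x
    using bound[of 1 x] bound[of "- 1" x] by simp
  with lin_R R_nz show ?thesis
    by blast
qed

text \<open>Otherwise \<open>T\<close> composed with its adjoint is the identity, so
  \<open>T\<close> is onto and, by finite dimension, injective. Cancelling \<open>T\<close> shows
  that the adjoint sends \<open>T u\<close> back to \<open>u\<close>, whence \<open>T\<close>
  preserves the norm of \<open>u\<close>.\<close>

lemma exists_adjoint_pair:
  assumes fin: "finite_dimensional scale"
    and lin: "Vector_Spaces.linear scale scale T"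
    and u: "norm (T u) \<noteq> norm u"
  shows "\<exists>y z. (\<forall>x. ip (T x) y = ip x z) \<and> y \<noteq> T z"
proof (rule ccontr)
  assume "\<not> ?thesis"
  then have coisometry: "y = T z" if "\<forall>x. ip (T x) y = ip x z" for y z
    using that by blast
  interpret T: Vector_Spaces.linear scale scale T by fact
  have adj: "\<exists>z. \<forall>x. ip (T x) y = ip x z" for y
  proof (rule riesz_representation[OF fin])
    show "Vector_Spaces.linear scale (*) (\<lambda>x. ip (T x) y)"
      by (intro Vector_Spaces.linear.intro module_hom.intro)
         (unfold_locales, simp_all add: T.add T.scale ip_simps algebra_simps)
  qed
  have "surj T"
    using adj coisometry by (metis surjI)
  then have "inj T"
    by (rule surjective_imp_injective[OF fin lin])
  obtain z where z: "\<forall>x. ip (T x) (T u) = ip x z"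
    using adj by blast
  then have "z = u"
    using coisometry \<open>inj T\<close> by (metis injD)
  with z have "ip (T u) (T u) = ip u u"
    by blast
  then have "(norm (T u))\<^sup>2 = (norm u)\<^sup>2"
    by (simp only: ip_self of_real_eq_iff)
  with u show False
    by simp
qed

section \<open>From linear maps to bounded operators\<close>

lemma linear_scaleR:
  assumes "Vector_Spaces.linear scale scale f"
  shows "f (r *\<^sub>R x) = r *\<^sub>R f x"
proof -
  interpret f: Vector_Spaces.linear scale scale f by fact
  show ?thesis
    using f.scale[of "of_real r" x] by (simp add: scale_of_real)
qed

lemma linear_add_diff:
  assumes "Vector_Spaces.linear scale scale f" "Vector_Spaces.linear scale scale g"
  shows "Vector_Spaces.linear scale scale (\<lambda>x. f x + g x)"
    and "Vector_Spaces.linear scale scale (\<lambda>x. f x - g x)"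
proof -
  interpret f: Vector_Spaces.linear scale scale f by fact
  interpret g: Vector_Spaces.linear scale scale g by fact
  show "Vector_Spaces.linear scale scale (\<lambda>x. f x + g x)"
    by (intro Vector_Spaces.linear.intro module_hom.intro)
       (unfold_locales, simp_all add: f.add g.add f.scale g.scale algebra_simps)
  show "Vector_Spaces.linear scale scale (\<lambda>x. f x - g x)"
    by (intro Vector_Spaces.linear.intro module_hom.intro)
       (unfold_locales, simp_all add: f.add g.add f.scale g.scale algebra_simps)
qed

lemma exists_contraction_blinfun:
  assumes lin: "Vector_Spaces.linear scale scale f" and bound: "\<And>x. norm (f x) \<le> norm x"
  shows "\<exists>A. blinfun_apply A = f \<and> A \<in> cball 0 1 \<inter> bounded_operators scale"
proof -
  interpret f: Vector_Spaces.linear scale scale f by fact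
  have "bounded_linear f"
    by (rule bounded_linear_intro[where K = 1])
       (simp_all add: f.add linear_scaleR[OF lin] bound)
  then have A: "blinfun_apply (Blinfun f) = f"
    by (rule bounded_linear_Blinfun_apply)
  moreover have "norm (Blinfun f) \<le> 1"
    by (rule norm_blinfun_bound) (simp_all add: A bound)
  ultimately show ?thesis
    using lin by (intro exI[of _ "Blinfun f"]) (simp add: bounded_operators_def)
qed

section \<open>The two implications\<close>

lemma isometry_imp_extreme_contraction:
  assumes "T \<in> bounded_operators scale" "isometry T"
  shows "extreme_contraction scale T"
proof -
  have norm_T: "norm T \<le> 1"
    using assms(2) by (intro norm_blinfun_bound) (simp_all add: isometry_def)
  have "T \<notin> open_segment A B" if "norm A \<le> 1" "norm B \<le> 1" for A B
  proof
    assume "T \<in> open_segment A B"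
    then obtain t where t: "A \<noteq> B" "0 < t" "t < 1" "T = (1 - t) *\<^sub>R A + t *\<^sub>R B"
      unfolding in_segment by blast
    have "A x = B x" for x
    proof (rule strict_convexity)
      show "norm (A x) \<le> norm x" "norm (B x) \<le> norm x"
        using that by (auto intro: contraction_norm_le simp: contraction_def)
      show "norm ((1 - t) *\<^sub>R A x + t *\<^sub>R B x) = norm x"
        using assms(2) by (simp add: isometry_def t(4) blinfun.bilinear_simps)
    qed (use t in auto)
    then show False
      using t(1) blinfun_eqI by blast
  qed
  then show ?thesis
    using assms(1) norm_T
    by (simp add: extreme_contraction_def contraction_def extreme_point_of_def)
qed

lemma extreme_contraction_imp_isometry:
  assumes fin: "finite_dimensional scale"
    and T: "T \<in> bounded_operators scale" "extreme_contraction scale T"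
  shows "isometry T"
proof (rule ccontr)
  assume "\<not> isometry T"
  then obtain u where u: "norm (T u) \<noteq> norm u"
    unfolding isometry_def by blast
  have lin: "Vector_Spaces.linear scale scale T"
    using T(1) by (simp add: bounded_operators_def)
  have contr: "norm (T x) \<le> norm x" for x
    using T(2) by (simp add: extreme_contraction_def contraction_norm_le)
  obtain R v where R: "Vector_Spaces.linear scale scale R" "R v \<noteq> 0"
    "\<And>x. norm (T x + R x) \<le> norm x" "\<And>x. norm (T x - R x) \<le> norm x"
    using exists_adjoint_pair[OF fin lin u] exists_nonzero_perturbation[OF lin contr u] by metis
  obtain A where A: "blinfun_apply A = (\<lambda>x. T x + R x)"
    "A \<in> cball 0 1 \<inter> bounded_operators scale"
    using exists_contraction_blinfun[OF linear_add_diff(1)[OF lin R(1)] R(3)] by blast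
  obtain B where B: "blinfun_apply B = (\<lambda>x. T x - R x)"
    "B \<in> cball 0 1 \<inter> bounded_operators scale"
    using exists_contraction_blinfun[OF linear_add_diff(2)[OF lin R(1)] R(4)] by blast
  have "T = midpoint A B"
    by (rule blinfun_eqI)
       (simp add: midpoint_def A(1) B(1) blinfun.bilinear_simps scaleR_2[symmetric])
  moreover have "A \<noteq> B"
  proof
    assume "A = B"
    then have "T v + R v = T v - R v"
      using A(1) B(1) by metis
    moreover have "2 *\<^sub>R R v = (T v + R v) - (T v - R v)"
      by (simp add: scaleR_2)
    ultimately have "2 *\<^sub>R R v = 0"
      by simp
    with R(2) show False
      by simp
  qed
  ultimately have "T \<in> open_segment A B"
    by simp
  then show False
    using T(2) A(2) B(2) unfolding extreme_contraction_def extreme_point_of_def by blast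
qed

end

section \<open>The real and complex instances\<close>

lemma real_inner_product_space:
  "inner_product_space (scaleR :: real \<Rightarrow> 'a::real_inner \<Rightarrow> 'a) inner (\<lambda>r. r)"
  by unfold_locales
     (simp_all add: algebra_simps inner_commute dot_square_norm power2_eq_square[symmetric])

lemma complex_inner_product_space:
  "inner_product_space (scaleC :: complex \<Rightarrow> 'a::complex_inner \<Rightarrow> 'a) cinner cnj"
proof unfold_locales
  fix x :: 'a
  \<comment> \<open>The class axioms give the norm only through the real part, so the imaginary part
    must first be shown to vanish.\<close>
  have "cinner x x \<in> \<real>"
    using cinner_commute[of x x] by (simp add: Reals_cnj_iff)
  then show "cinner x x = of_real ((norm x)\<^sup>2)"
    by (simp add: norm_eq_sqrt_cinner cinner_ge_zero of_real_Re)
qed (simp_all add: scaleC_of_real cinner_add_left cinner_scaleC_left cinner_commute[symmetric]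
       complex_norm_square del: of_real_power)

theorem theorem2p6:
  fixes T :: "'a::{real_inner, banach} \<Rightarrow>\<^sub>L 'a"
    and U :: "'b::{complex_inner, banach} \<Rightarrow>\<^sub>L 'b"
  shows "(finite_dimensional (scaleR :: real \<Rightarrow> 'a \<Rightarrow> 'a) \<and> T \<in> bounded_operators scaleR \<longrightarrow>
            (extreme_contraction scaleR T \<longleftrightarrow> isometry T)) \<and>
         (finite_dimensional (scaleC :: complex \<Rightarrow> 'b \<Rightarrow> 'b) \<and> U \<in> bounded_operators scaleC \<longrightarrow>
            (extreme_contraction scaleC U \<longleftrightarrow> isometry U))"
  using inner_product_space.isometry_imp_extreme_contraction[OF real_inner_product_space]
    inner_product_space.extreme_contraction_imp_isometry[OF real_inner_product_space]
    inner_product_space.isometry_imp_extreme_contraction[OF complex_inner_product_space]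
    inner_product_space.extreme_contraction_imp_isometry[OF complex_inner_product_space]
  by blast

end
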